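(* Let $M\ge 1$ be an integer, let $\mathcal{Z}$ be a set of prompts, and let $\theta^*:\mathcal{Z}\to\mathbb{R}^M$. Assume that for every prompt $z\in\mathcal{Z}$ the Bradley-Terry model holds with coefficients $\theta^*(z)$, i.e. conditionally on the prompt $z$, model $b$ beats model $a$ with probability $\sigma(\theta^*(z)_b-\theta^*(z)_a)$. Let $c=(c_1,\dots,c_M)\in\mathbb{R}^M$ be a vector of costs, $C\in\mathbb{R}$ a budget, and $q\in\Delta^M$ a distribution over opponent models. Fix any $z\in\mathcal{Z}$ and let $\mathbf{W}^*\in\mathbb{R}^{M\times M}$ be the matrix with entries $\mathbf{W}^*_{ba}=\sigma(\theta^*(z)_b-\theta^*(z)_a)$. Consider the following three optimization problems. (P1) (maximal win rate) $$\text{maximize over } \tilde\pi\in\Delta^M:\quad \mathbb{P}_{A\sim q,\ B\sim\tilde\pi,\ Y\sim\mathrm{Bern}(\sigma(\theta^*(z)_B-\theta^*(z)_A))}(Y=1)\qquad\text{subject to } \mathbb{E}_{B\sim\tilde\pi}[c_B]\le C.$$ (P2) (maximal Bradley-Terry coefficient) $$\text{maximize over } \tilde\pi\in\Delta^M:\quad \operatorname*{argmin}_{\theta\in\mathbb{R}}\ \mathbb{E}_{B\sim\tilde\pi,\ A\sim q,\ Y'\sim\mathrm{Bern}(\sigma(\theta^*(z)_B-\theta^*(z)_A))}\big[\ell(\sigma(\theta-\theta^*(z)_A),Y')\big]\qquad\text{subject to } \mathbb{E}_{B\sim\tilde\pi}[c_B]\le C.$$ (P3) (linear program) $$\text{minimize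 over } \tilde\pi\in\mathbb{R}^M:\quad -\tilde\pi^\top\mathbf{W}^*q\qquad\text{subject to } \tilde\pi^\top c\le C,\quad \mathbf{0}_M\preceq\tilde\pi\preceq\mathbf{1}_M,\quad \tilde\pi^\top\mathbf{1}_M=1.$$ Then (P1) and (P2) are both equivalent to (P3): the three problems have the same feasible set and the same set of optimal solutions $\tilde\pi$.
   Context: Notation: $[M]=\{1,\dots,M\}$ indexes the models. $\Delta^M$ is the set of probability vectors on $[M]$, i.e. $\{p\in\mathbb{R}^M: p_i\ge 0,\ \sum_i p_i=1\}$. $\sigma(t)=1/(1+e^{-t})$ is the sigmoid function. $\ell(p,y)=-y\log p-(1-y)\log(1-p)$ is the binary cross-entropy loss, for $p\in(0,1)$ and $y\in[0,1]$. $\mathrm{Bern}(p)$ is the Bernoulli distribution on $\{0,1\}$ with success probability $p$. $\mathbf{0}_M,\mathbf{1}_M\in\mathbb{R}^M$ are the all-zeros and all-ones vectors, and $\preceq$ is the entrywise inequality. In (P1) and (P2), $A\sim q$ and $B\sim\tilde\pi$ are drawn independently from $[M]$ (possibly $A=B$), and then, given $A$ and $B$, the binary vote ($Y$ or $Y'$) is drawn from the stated Bernoulli distribution; all of this is conditional on the fixed prompt $z$. In (P2), the objective value at $\tilde\pi$ is the real number $\theta$ that minimizes the displayed expected loss over $\theta\in\mathbb{R}$ (the minimizer itself, not the minimum value of the loss). It is the Bradley-Terry coefficient assigned to the router that samples its model from $\tilde\pi$ when it is compared against opponents drawn from $q$. *)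

theory Defs
  imports "HOL-Probability.Probability"
begin

text \<open>
  The models are the elements of a finite type \<open>'m\<close>, so \<open>M = CARD('m) \<ge> 1\<close>. The order on
  \<^typ>\<open>real ^ 'm\<close> is the entrywise one, and \<^term>\<open>1 :: real ^ 'm\<close> is the all-ones vector.
\<close>

definition prob_simplex :: "(real ^ 'm::finite) set" where
  "prob_simplex = {p. (\<forall>i. 0 \<le> p $ i) \<and> (\<Sum>i\<in>UNIV. p $ i) = 1}"

text \<open>The distribution on the models with weights \<open>p\<close>; meaningful only for \<open>p\<close> in \<^const>\<open>prob_simplex\<close>.\<close>

definition vec_pmf :: "real ^ 'm::finite \<Rightarrow> 'm pmf" where
  "vec_pmf p = embed_pmf (\<lambda>i. p $ i)"

definition sigmoid :: "real \<Rightarrow> real" where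
  "sigmoid t = 1 / (1 + exp (- t))"

definition bce_loss :: "real \<Rightarrow> real \<Rightarrow> real" where
  "bce_loss p y = - y * ln p - (1 - y) * ln (1 - p)"

text \<open>
  \<open>vote z a b\<close> is the conditional law, given the prompt \<open>z\<close>, of the comparison of model \<open>b\<close>
  against model \<open>a\<close>, where \<^const>\<open>True\<close> means that \<open>b\<close> beats \<open>a\<close>.
\<close>

definition bradley_terry ::
    "'z set \<Rightarrow> ('z \<Rightarrow> 'm::finite \<Rightarrow> 'm \<Rightarrow> bool pmf) \<Rightarrow> ('z \<Rightarrow> real ^ 'm) \<Rightarrow> bool" where
  "bradley_terry Z vote \<theta> \<longleftrightarrow>
     (\<forall>z\<in>Z. \<forall>a b. pmf (vote z a b) True = sigmoid (\<theta> z $ b - \<theta> z $ a))"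

text \<open>
  Joint law of \<open>(A, B, Y)\<close>, with \<open>\<theta>\<close> the coefficient vector at a fixed prompt; the vote \<open>Y\<close> is
  a \<^typ>\<open>bool\<close>, with \<^const>\<open>True\<close> standing for 1.
\<close>

definition comparison_pmf ::
    "real ^ 'm::finite \<Rightarrow> real ^ 'm \<Rightarrow> real ^ 'm \<Rightarrow> ('m \<times> 'm \<times> bool) pmf" where
  "comparison_pmf \<theta> q \<pi> =
     do {
       (A, B) \<leftarrow> pair_pmf (vec_pmf q) (vec_pmf \<pi>);
       Y \<leftarrow> bernoulli_pmf (sigmoid (\<theta> $ B - \<theta> $ A));
       return_pmf (A, B, Y)
     }"

definition win_rate :: "real ^ 'm::finite \<Rightarrow> real ^ 'm \<Rightarrow> real ^ 'm \<Rightarrow> real" where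
  "win_rate \<theta> q \<pi> = measure_pmf.prob (comparison_pmf \<theta> q \<pi>) {(A, B, Y). Y}"

definition bt_loss :: "real ^ 'm::finite \<Rightarrow> real ^ 'm \<Rightarrow> real ^ 'm \<Rightarrow> real \<Rightarrow> real" where
  "bt_loss \<theta> q \<pi> t =
     measure_pmf.expectation (comparison_pmf \<theta> q \<pi>)
       (\<lambda>(A, B, Y). bce_loss (sigmoid (t - \<theta> $ A)) (of_bool Y))"

definition bt_coefficient :: "real ^ 'm::finite \<Rightarrow> real ^ 'm \<Rightarrow> real ^ 'm \<Rightarrow> real" where
  "bt_coefficient \<theta> q \<pi> = arg_min (bt_loss \<theta> q \<pi>) (\<lambda>t. True)"

definition router_feasible :: "real ^ 'm::finite \<Rightarrow> real \<Rightarrow> (real ^ 'm) set" where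
  "router_feasible c C =
     {\<pi> \<in> prob_simplex. measure_pmf.expectation (vec_pmf \<pi>) (\<lambda>B. c $ B) \<le> C}"

definition win_matrix :: "real ^ 'm::finite \<Rightarrow> real ^ 'm ^ 'm" where
  "win_matrix \<theta> = (\<chi> b a. sigmoid (\<theta> $ b - \<theta> $ a))"

definition lp_objective :: "real ^ 'm::finite \<Rightarrow> real ^ 'm \<Rightarrow> real ^ 'm \<Rightarrow> real" where
  "lp_objective \<theta> q \<pi> = - (\<pi> \<bullet> (win_matrix \<theta> *v q))"

definition lp_feasible :: "real ^ 'm::finite \<Rightarrow> real \<Rightarrow> (real ^ 'm) set" where
  "lp_feasible c C = {\<pi>. \<pi> \<bullet> c \<le> C \<and> 0 \<le> \<pi> \<and> \<pi> \<le> 1 \<and> \<pi> \<bullet> 1 = 1}"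

end

theory Submission
  imports Defs
begin

text \<open>
  With \<open>s = t - \<theta>\<^sub>a\<close>, the loss is \<open>ln (1 + exp s) - y s\<close>, so the expected loss has derivative
  \<open>G t - W \<pi>\<close>, where \<open>G t = (\<Sum>a. q\<^sub>a \<sigma>(t - \<theta>\<^sub>a))\<close> is the win rate of a model with coefficient \<open>t\<close>
  and \<open>W \<pi>\<close> is the win rate of the router. The function \<open>G\<close> is continuous and strictly
  increasing, and \<open>W \<pi> = (\<Sum>b. \<pi>\<^sub>b G \<theta>\<^sub>b)\<close> is an average of its values, so the loss has a unique
  minimizer, the solution of \<open>G t = W \<pi>\<close>. Hence the Bradley--Terry coefficient is a strictly
  increasing function of the win rate, which in turn is minus the objective of the linear program.
\<close>

section \<open>The sigmoid and the cross-entropy loss\<close>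

lemma sigmoid_bounds: "0 < sigmoid t" "sigmoid t < 1"
  by (auto simp: sigmoid_def field_simps add_pos_pos)

lemma strict_mono_sigmoid: "strict_mono sigmoid"
  by (auto intro!: strict_monoI divide_strict_left_mono simp: sigmoid_def add_pos_pos)

lemma continuous_on_sigmoid [continuous_intros]:
  assumes "continuous_on S f"
  shows "continuous_on S (\<lambda>x. sigmoid (f x))"
  unfolding sigmoid_def using assms
  by (intro continuous_intros) (auto simp: add_pos_pos less_imp_neq[symmetric])

lemma sigmoid_eq_exp: "sigmoid t = exp t / (1 + exp t)"
  by (simp add: sigmoid_def exp_minus field_simps add_pos_pos)

text \<open>Both logarithms contain \<open>- ln (1 + exp s)\<close>, with weights \<open>y\<close>
  and \<open>1 - y\<close> that sum to 1; only \<open>ln (sigmoid s)\<close> adds a linear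
  term.\<close>

lemma bce_loss_sigmoid: "bce_loss (sigmoid s) y = ln (1 + exp s) - y * s"
proof -
  have pos: "0 < 1 + exp s" by (simp add: add_pos_pos)
  have ln_sigmoid: "ln (sigmoid s) = s - ln (1 + exp s)"
    using pos by (simp add: sigmoid_eq_exp ln_div)
  have "1 - sigmoid s = 1 / (1 + exp s)"
    using pos by (simp add: sigmoid_eq_exp field_simps)
  hence ln_compl: "ln (1 - sigmoid s) = - ln (1 + exp s)"
    using pos by (simp add: ln_div)
  show ?thesis
    unfolding bce_loss_def ln_sigmoid ln_compl by (simp add: algebra_simps)
qed

section \<open>Expectations as finite sums\<close>

lemma pmf_vec_pmf:
  fixes p :: "real ^ 'm::finite"
  assumes "p \<in> prob_simplex"
  shows "pmf (vec_pmf p) i = p $ i"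
  unfolding vec_pmf_def
proof (rule pmf_embed_pmf)
  show "0 \<le> p $ i" for i using assms by (simp add: prob_simplex_def)
  have "(\<integral>\<^sup>+ i. ennreal (p $ i) \<partial>count_space UNIV) = (\<Sum>i\<in>UNIV. ennreal (p $ i))"
    by (rule nn_integral_count_space_finite) simp
  also have "\<dots> = 1"
    using assms by (simp add: prob_simplex_def sum_ennreal)
  finally show "(\<integral>\<^sup>+ i. ennreal (p $ i) \<partial>count_space UNIV) = 1" .
qed

lemma expectation_vec_pmf:
  fixes p :: "real ^ 'm::finite" and f :: "'m \<Rightarrow> real"
  assumes "p \<in> prob_simplex"
  shows "measure_pmf.expectation (vec_pmf p) f = (\<Sum>i\<in>UNIV. p $ i * f i)"
  by (subst integral_measure_pmf[of UNIV]) (simp_all add: pmf_vec_pmf assms)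

text \<open>An arbitrary \<open>h\<close> covers both uses: the indicator of a win gives the win
  rate, the cross-entropy gives the expected loss.\<close>

lemma expectation_comparison_pmf:
  fixes \<theta> q \<pi> :: "real ^ 'm::finite" and h :: "'m \<times> 'm \<times> bool \<Rightarrow> real"
  assumes q: "q \<in> prob_simplex" and \<pi>: "\<pi> \<in> prob_simplex"
  shows "measure_pmf.expectation (comparison_pmf \<theta> q \<pi>) h =
    (\<Sum>b\<in>UNIV. \<Sum>a\<in>UNIV. \<pi> $ b * q $ a *
       (sigmoid (\<theta> $ b - \<theta> $ a) * h (a, b, True)
        + (1 - sigmoid (\<theta> $ b - \<theta> $ a)) * h (a, b, False)))"
proof -
  have Bern: "measure_pmf.expectation
      (bernoulli_pmf (sigmoid t) \<bind> (\<lambda>Y. return_pmf (a, b, Y))) h =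
      sigmoid t * h (a, b, True) + (1 - sigmoid t) * h (a, b, False)" for t a b
    using sigmoid_bounds[of t]
    by (subst pmf_expectation_bind[of UNIV]) (auto simp: UNIV_bool)
  have "measure_pmf.expectation (comparison_pmf \<theta> q \<pi>) h =
    (\<Sum>x\<in>UNIV. pmf (pair_pmf (vec_pmf q) (vec_pmf \<pi>)) x *\<^sub>R
       measure_pmf.expectation (case x of (a, b) \<Rightarrow>
         bernoulli_pmf (sigmoid (\<theta> $ b - \<theta> $ a)) \<bind> (\<lambda>Y. return_pmf (a, b, Y))) h)"
    unfolding comparison_pmf_def by (rule pmf_expectation_bind) auto
  also have "\<dots> = (\<Sum>(a, b)\<in>UNIV \<times> UNIV. \<pi> $ b * q $ a *
       (sigmoid (\<theta> $ b - \<theta> $ a) * h (a, b, True)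
        + (1 - sigmoid (\<theta> $ b - \<theta> $ a)) * h (a, b, False)))"
    by (intro sum.cong) (auto simp: pmf_pair pmf_vec_pmf q \<pi> Bern mult_ac)
  also have "\<dots> = (\<Sum>a\<in>UNIV. \<Sum>b\<in>UNIV. \<pi> $ b * q $ a *
       (sigmoid (\<theta> $ b - \<theta> $ a) * h (a, b, True)
        + (1 - sigmoid (\<theta> $ b - \<theta> $ a)) * h (a, b, False)))"
    by (rule sum.cartesian_product[symmetric])
  \<comment> \<open>With the router's index outermost, the inner sum over opponents can become
    \<open>model_win_rate\<close>.\<close>
  also note sum.swap
  finally show ?thesis .
qed

text \<open>The \<open>G\<close> of the overview. It extends to every real \<open>t\<close> the
  entries of \<open>win_matrix \<theta> *v q\<close>, which are its values at
  \<open>\<theta> $ b\<close>.\<close>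

definition model_win_rate :: "real ^ 'm::finite \<Rightarrow> real ^ 'm \<Rightarrow> real \<Rightarrow> real" where
  "model_win_rate \<theta> q t = (\<Sum>a\<in>UNIV. q $ a * sigmoid (t - \<theta> $ a))"

lemma win_rate_eq:
  assumes "q \<in> prob_simplex" "\<pi> \<in> prob_simplex"
  shows "win_rate \<theta> q \<pi> = (\<Sum>b\<in>UNIV. \<pi> $ b * model_win_rate \<theta> q (\<theta> $ b))"
proof -
  have "win_rate \<theta> q \<pi> =
      measure_pmf.expectation (comparison_pmf \<theta> q \<pi>) (indicator {(A, B, Y). Y})"
    by (simp add: win_rate_def)
  thus ?thesis
    unfolding expectation_comparison_pmf[OF assms]
    by (simp add: model_win_rate_def sum_distrib_left mult.assoc)
qed

lemma lp_objective_eq: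
  assumes "q \<in> prob_simplex" "\<pi> \<in> prob_simplex"
  shows "lp_objective \<theta> q \<pi> = - win_rate \<theta> q \<pi>"
  by (simp add: win_rate_eq assms lp_objective_def win_matrix_def matrix_vector_mult_def
      model_win_rate_def inner_vec_def mult.commute)

lemma bt_loss_eq:
  assumes "q \<in> prob_simplex" "\<pi> \<in> prob_simplex"
  shows "bt_loss \<theta> q \<pi> t = (\<Sum>b\<in>UNIV. \<Sum>a\<in>UNIV. \<pi> $ b * q $ a *
    (ln (1 + exp (t - \<theta> $ a)) - sigmoid (\<theta> $ b - \<theta> $ a) * (t - \<theta> $ a)))"
  unfolding bt_loss_def expectation_comparison_pmf[OF assms]
  by (intro sum.cong refl) (simp add: bce_loss_sigmoid algebra_simps)

section \<open>The derivative of the loss and its root\<close>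

lemma bt_loss_deriv:
  assumes q: "q \<in> prob_simplex" and \<pi>: "\<pi> \<in> prob_simplex"
  shows "(bt_loss \<theta> q \<pi> has_real_derivative model_win_rate \<theta> q t - win_rate \<theta> q \<pi>) (at t)"
proof -
  have "((\<lambda>t. bt_loss \<theta> q \<pi> t) has_real_derivative
      (\<Sum>b\<in>UNIV. \<Sum>a\<in>UNIV. \<pi> $ b * q $ a *
        (sigmoid (t - \<theta> $ a) - sigmoid (\<theta> $ b - \<theta> $ a)))) (at t)"
    unfolding bt_loss_eq[OF assms]
    by (auto intro!: derivative_eq_intros sum.cong simp: sigmoid_eq_exp[of "t - _"] add_pos_pos)
  \<comment> \<open>The term \<open>sigmoid (t - \<theta> $ a)\<close> is free of \<open>b\<close>,
    so its double sum factors; the total weight of \<open>\<pi>\<close> is replaced by 1 only at the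
    end.\<close>
  also have "(\<Sum>b\<in>UNIV. \<Sum>a\<in>UNIV. \<pi> $ b * q $ a *
        (sigmoid (t - \<theta> $ a) - sigmoid (\<theta> $ b - \<theta> $ a))) =
      (\<Sum>b\<in>UNIV. \<pi> $ b) * model_win_rate \<theta> q t - win_rate \<theta> q \<pi>"
    unfolding win_rate_eq[OF assms] model_win_rate_def sum_product
    by (simp add: sum_distrib_left right_diff_distrib sum_subtractf mult.assoc)
  finally show ?thesis using \<pi> by (simp add: prob_simplex_def)
qed

text \<open>No summand decreases; strictness comes from an opponent of positive weight, which exists
  because the weights sum to 1.\<close>

lemma strict_mono_model_win_rate:
  assumes "q \<in> prob_simplex"
  shows "strict_mono (model_win_rate \<theta> q)"
proof (rule strict_monoI)
  fix s t :: real assume "s < t"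
  hence lt: "sigmoid (s - \<theta> $ a) < sigmoid (t - \<theta> $ a)" for a
    using strict_mono_sigmoid by (simp add: strict_mono_less)
  have q: "0 \<le> q $ a" for a using assms by (simp add: prob_simplex_def)
  have "\<exists>a. q $ a \<noteq> 0"
    using assms by (auto simp: prob_simplex_def intro: ccontr)
  then obtain a where "0 < q $ a" using q by (metis less_eq_real_def)
  thus "model_win_rate \<theta> q s < model_win_rate \<theta> q t"
    unfolding model_win_rate_def using q lt
    by (intro sum_strict_mono_ex1)
      (auto intro: mult_left_mono less_imp_le exI[of _ a] mult_strict_left_mono)
qed

text \<open>The average lies between the values of \<open>G\<close> at the least and the greatest
  coefficient, so the intermediate value theorem applies between these two points.\<close>

lemma model_win_rate_attains:
  fixes \<theta> q \<pi> :: "real ^ 'm::finite"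
  assumes q: "q \<in> prob_simplex" and \<pi>: "\<pi> \<in> prob_simplex"
  obtains t where "model_win_rate \<theta> q t = win_rate \<theta> q \<pi>"
proof -
  define G where "G = model_win_rate \<theta> q"
  define l u where "l = Min (range (($) \<theta>))" and "u = Max (range (($) \<theta>))"
  have lu: "l \<le> \<theta> $ b" "\<theta> $ b \<le> u" for b by (auto simp: l_def u_def)
  have G: "G l \<le> G (\<theta> $ b)" "G (\<theta> $ b) \<le> G u" for b
    using lu strict_mono_model_win_rate[OF q] by (simp_all add: G_def strict_mono_less_eq)
  have \<pi>': "0 \<le> \<pi> $ b" "(\<Sum>b\<in>UNIV. \<pi> $ b) = 1" for b
    using \<pi> by (auto simp: prob_simplex_def)
  have "(\<Sum>b\<in>UNIV. \<pi> $ b * G l) \<le> win_rate \<theta> q \<pi>"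
    "win_rate \<theta> q \<pi> \<le> (\<Sum>b\<in>UNIV. \<pi> $ b * G u)"
    unfolding win_rate_eq[OF assms] G_def[symmetric]
    by (auto intro!: sum_mono mult_left_mono G \<pi>')
  hence bd: "G l \<le> win_rate \<theta> q \<pi>" "win_rate \<theta> q \<pi> \<le> G u"
    by (simp_all add: sum_distrib_right[symmetric] \<pi>')
  have "continuous_on {l..u} G"
    unfolding G_def model_win_rate_def by (intro continuous_intros)
  moreover have "l \<le> u" using lu order_trans by blast
  ultimately obtain t where "G t = win_rate \<theta> q \<pi>"
    using IVT'[of G l "win_rate \<theta> q \<pi>" u] bd by blast
  thus thesis using that by (simp add: G_def)
qed

text \<open>The derivative is negative to the left of \<open>x\<close> and positive to the right, so
  \<open>f\<close> strictly decreases towards \<open>x\<close> and strictly increases after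
  it.\<close>

lemma strict_minimum_deriv_strict_mono:
  fixes f f' :: "real \<Rightarrow> real"
  assumes deriv: "\<And>x. (f has_real_derivative f' x) (at x)"
    and mono: "strict_mono f'" and zero: "f' x = 0" and "y \<noteq> x"
  shows "f x < f y"
proof (cases "x < y")
  case True
  show ?thesis
    using True
  proof (rule DERIV_pos_imp_increasing_open)
    show "\<exists>D. DERIV f w :> D \<and> D > 0" if "x < w" for w
      using deriv that strict_monoD[OF mono that] zero by auto
    show "continuous_on {x..y} f"
      using deriv by (intro DERIV_continuous_on) (blast intro: has_field_derivative_at_within)
  qed
next
  case False
  hence "y < x" using \<open>y \<noteq> x\<close> by simp
  thus ?thesis
  proof (rule DERIV_neg_imp_decreasing_open)
    show "\<exists>D. DERIV f w :> D \<and> D < 0" if "w < x" for w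
      using deriv that strict_monoD[OF mono that] zero by auto
    show "continuous_on {y..x} f"
      using deriv by (intro DERIV_continuous_on) (blast intro: has_field_derivative_at_within)
  qed
qed

section \<open>The Bradley-Terry coefficient as the unique minimizer\<close>

lemma is_arg_min_bt_loss_iff:
  assumes q: "q \<in> prob_simplex" and \<pi>: "\<pi> \<in> prob_simplex"
  shows "is_arg_min (bt_loss \<theta> q \<pi>) (\<lambda>t. True) t \<longleftrightarrow> model_win_rate \<theta> q t = win_rate \<theta> q \<pi>"
proof -
  have less: "bt_loss \<theta> q \<pi> s < bt_loss \<theta> q \<pi> t"
    if "model_win_rate \<theta> q s = win_rate \<theta> q \<pi>" "t \<noteq> s" for s t
    using bt_loss_deriv[OF assms]
  proof (rule strict_minimum_deriv_strict_mono)
    show "strict_mono (\<lambda>t. model_win_rate \<theta> q t - win_rate \<theta> q \<pi>)"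
      using strict_mono_model_win_rate[OF q] by (simp add: strict_mono_def)
  qed (use that in auto)
  \<comment> \<open>For the converse: \<open>t0\<close> has strictly smaller loss than any other
    point, so a minimizer must equal \<open>t0\<close>.\<close>
  obtain t0 where "model_win_rate \<theta> q t0 = win_rate \<theta> q \<pi>"
    using model_win_rate_attains[OF assms] .
  with less show ?thesis
    unfolding is_arg_min_def by (metis less_asym)
qed

text \<open>This justifies \<open>bt_coefficient\<close>: \<open>arg_min\<close> is a choice
  operator, and its value is determined only when exactly one minimizer exists.\<close>

lemma ex1_arg_min_bt_loss:
  assumes q: "q \<in> prob_simplex" and \<pi>: "\<pi> \<in> prob_simplex"
  shows "\<exists>!t. is_arg_min (bt_loss \<theta> q \<pi>) (\<lambda>t. True) t"
  unfolding is_arg_min_bt_loss_iff[OF assms]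
  using model_win_rate_attains[OF assms] strict_mono_eq[OF strict_mono_model_win_rate[OF q]]
  by metis

lemma model_win_rate_bt_coefficient:
  assumes "q \<in> prob_simplex" "\<pi> \<in> prob_simplex"
  shows "model_win_rate \<theta> q (bt_coefficient \<theta> q \<pi>) = win_rate \<theta> q \<pi>"
proof -
  have "is_arg_min (bt_loss \<theta> q \<pi>) (\<lambda>t. True) (bt_coefficient \<theta> q \<pi>)"
    unfolding bt_coefficient_def arg_min_def
    by (rule someI_ex[OF ex1_implies_ex[OF ex1_arg_min_bt_loss[OF assms]]])
  thus ?thesis by (simp add: is_arg_min_bt_loss_iff[OF assms])
qed

text \<open>The strictly increasing \<open>G\<close> maps coefficients to win rates, so it preserves
  and reflects strict order.\<close>

lemma bt_coefficient_less_iff: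
  assumes "q \<in> prob_simplex" "\<pi> \<in> prob_simplex" "\<pi>' \<in> prob_simplex"
  shows "bt_coefficient \<theta> q \<pi> < bt_coefficient \<theta> q \<pi>' \<longleftrightarrow> win_rate \<theta> q \<pi> < win_rate \<theta> q \<pi>'"
  using strict_mono_less[OF strict_mono_model_win_rate[OF assms(1)]]
  by (metis model_win_rate_bt_coefficient assms)

section \<open>Feasible sets and optimal solutions\<close>

lemma router_feasible_eq_lp_feasible: "router_feasible c C = lp_feasible c C"
proof -
  \<comment> \<open>The upper bound is the only linear-program constraint not explicit in the
    simplex or the budget: a nonnegative entry is at most the total.\<close>
  have le1: "\<pi> $ i \<le> 1" if "\<pi> \<in> prob_simplex" for \<pi> :: "real ^ 'a" and i
    using that member_le_sum[of i UNIV "($) \<pi>"] by (simp add: prob_simplex_def)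
  show ?thesis
    by (auto simp: router_feasible_def lp_feasible_def expectation_vec_pmf inner_vec_def
        less_eq_vec_def le1)
       (auto simp: prob_simplex_def expectation_vec_pmf)
qed

theorem theorem1:
  fixes Z :: "'z set"
    and vote :: "'z \<Rightarrow> 'm::finite \<Rightarrow> 'm \<Rightarrow> bool pmf"
    and \<theta> :: "'z \<Rightarrow> real ^ 'm"
    and c q :: "real ^ 'm"
    and C :: real
    and z :: 'z
  assumes "bradley_terry Z vote \<theta>"
    and "q \<in> prob_simplex"
    and "z \<in> Z"
  shows "(\<forall>\<pi>\<in>prob_simplex. \<exists>!t. is_arg_min (bt_loss (\<theta> z) q \<pi>) (\<lambda>t. True) t)
     \<and> (router_feasible c C = lp_feasible c C)
     \<and> ({\<pi>. is_arg_max (win_rate (\<theta> z) q) (\<lambda>\<pi>. \<pi> \<in> router_feasible c C) \<pi>}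
          = {\<pi>. is_arg_min (lp_objective (\<theta> z) q) (\<lambda>\<pi>. \<pi> \<in> lp_feasible c C) \<pi>})
     \<and> ({\<pi>. is_arg_max (bt_coefficient (\<theta> z) q) (\<lambda>\<pi>. \<pi> \<in> router_feasible c C) \<pi>}
          = {\<pi>. is_arg_min (lp_objective (\<theta> z) q) (\<lambda>\<pi>. \<pi> \<in> lp_feasible c C) \<pi>})"
proof -
  note q = assms(2)
  \<comment> \<open>The objectives are related only on the simplex, so every feasible competitor
    must be placed there.\<close>
  have simplex: "\<pi> \<in> prob_simplex" if "\<pi> \<in> lp_feasible c C" for \<pi>
    using that by (simp add: router_feasible_eq_lp_feasible[symmetric] router_feasible_def)
  have "is_arg_max (win_rate (\<theta> z) q) (\<lambda>\<pi>. \<pi> \<in> lp_feasible c C) \<pi> \<longleftrightarrow>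
      is_arg_min (lp_objective (\<theta> z) q) (\<lambda>\<pi>. \<pi> \<in> lp_feasible c C) \<pi>" for \<pi>
    unfolding is_arg_max_def is_arg_min_def
    using lp_objective_eq[OF q simplex] by (metis neg_less_iff_less)
  \<comment> \<open>Optimality only says that no feasible point is strictly better, so objectives
    with the same strict comparisons have the same maximizers.\<close>
  moreover have "is_arg_max (bt_coefficient (\<theta> z) q) (\<lambda>\<pi>. \<pi> \<in> lp_feasible c C) \<pi> \<longleftrightarrow>
      is_arg_max (win_rate (\<theta> z) q) (\<lambda>\<pi>. \<pi> \<in> lp_feasible c C) \<pi>" for \<pi>
    unfolding is_arg_max_def
    using bt_coefficient_less_iff[OF q simplex simplex] by metis
  ultimately show ?thesis
    using ex1_arg_min_bt_loss[OF q] by (simp add: router_feasible_eq_lp_feasible)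
qed

end
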